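(* Let $k\ge 1$ be an integer, and suppose that every finite simple $K_{k+1}$-minor-free graph is $k$-colorable (i.e. has a proper vertex coloring with at most $k$ colors). Then every finite simple $K_{k+1}$-minor-free graph $G$ satisfies $\chi_{\rm o}(G)\le 2k-1$.
   Context: All graphs are finite and simple. $N_G(v)$ denotes the open neighborhood of $v$ in $G$. A graph $H$ is a minor of $G$ if $H$ can be obtained from $G$ by deleting edges and/or vertices and contracting edges; $G$ is $H$-minor-free if $H$ is not a minor of $G$. An odd coloring of $G$ is a proper vertex coloring in which, for every nonisolated vertex $v$, some color occurs an odd number of times in $N_G(v)$. $\chi_{\rm o}(G)$ is the minimum number of colors in an odd coloring of $G$. *)

theory Defs
  imports "Graph_Theory.Graph_Theory"
begin

text \<open>
  A finite simple graph is a \<^locale>\<open>pair_graph\<close> of the AFP entry "Graph Theory": finite, loopless and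
  symmetric, so an edge uv is the pair of arcs (u,v) and (v,u). The graph without vertices is allowed.
\<close>

definition neighborhood :: "'a pair_pre_digraph \<Rightarrow> 'a \<Rightarrow> 'a set" where
  "neighborhood G v = {u. (v, u) \<in> parcs G}"

definition complete_graph :: "nat \<Rightarrow> nat pair_pre_digraph" where
  "complete_graph n = \<lparr>pverts = {..<n}, parcs = {(i, j). i < n \<and> j < n \<and> i \<noteq> j}\<rparr>"

lemma complete_graph_is_complete: "complete_digraph n (with_proj (complete_graph n))"
  by (auto simp: complete_digraph_pair_def complete_graph_def)

definition delete_edge :: "'a pair_pre_digraph \<Rightarrow> 'a \<Rightarrow> 'a \<Rightarrow> 'a pair_pre_digraph" where
  "delete_edge G u v = \<lparr>pverts = pverts G, parcs = parcs G - {(u, v), (v, u)}\<rparr>"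

definition delete_vertex :: "'a pair_pre_digraph \<Rightarrow> 'a \<Rightarrow> 'a pair_pre_digraph" where
  "delete_vertex G v =
     \<lparr>pverts = pverts G - {v}, parcs = {(x, y). (x, y) \<in> parcs G \<and> x \<noteq> v \<and> y \<noteq> v}\<rparr>"

text \<open>
  Contraction of the edge uv: the merged vertex keeps the name u, the vertex v disappears, and the
  loop that arises from uv is discarded (parallel edges are identified automatically).
\<close>

definition contract_edge :: "'a pair_pre_digraph \<Rightarrow> 'a \<Rightarrow> 'a \<Rightarrow> 'a pair_pre_digraph" where
  "contract_edge G u v = (let f = (\<lambda>x. if x = v then u else x) in
     \<lparr>pverts = pverts G - {v}, parcs = {(f x, f y) |x y. (x, y) \<in> parcs G \<and> f x \<noteq> f y}\<rparr>)"

inductive minor_step :: "'a pair_pre_digraph \<Rightarrow> 'a pair_pre_digraph \<Rightarrow> bool" for G where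
  del_edge: "(u, v) \<in> parcs G \<Longrightarrow> minor_step G (delete_edge G u v)"
| del_vertex: "v \<in> pverts G \<Longrightarrow> minor_step G (delete_vertex G v)"
| contract: "(u, v) \<in> parcs G \<Longrightarrow> minor_step G (contract_edge G u v)"

lemma pair_graph_minor_step:
  assumes "pair_graph G" "minor_step G H"
  shows "pair_graph H"
proof -
  interpret pair_graph G by fact
  have sym: "(y, x) \<in> parcs G" if "(x, y) \<in> parcs G" for x y
    using that sym_arcs by (auto simp: symmetric_def elim: symE)
  have fin: "finite (pverts G)" "finite (parcs G)"
    using pair_finite_verts pair_finite_arcs by auto
  have wf: "x \<in> pverts G" "y \<in> pverts G" "x \<noteq> y" if "(x, y) \<in> parcs G" for x y
    using that in_arcsD1 in_arcsD2 no_loops' by auto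
  have I: "pair_graph K"
    if finK: "finite (pverts K)"
      and arcs: "\<And>x y. (x, y) \<in> parcs K \<Longrightarrow> x \<in> pverts K \<and> x \<noteq> y \<and> (y, x) \<in> parcs K"
    for K :: "'a pair_pre_digraph"
  proof -
    have K: "x \<in> pverts K" "y \<in> pverts K" "x \<noteq> y" "(y, x) \<in> parcs K" if "(x, y) \<in> parcs K" for x y
      using arcs[OF that] arcs[of y x] by blast+
    have "parcs K \<subseteq> pverts K \<times> pverts K" by (rule subrelI) (simp add: K(1,2))
    then have "finite (parcs K)" using finK by (meson finite_SigmaI finite_subset)
    moreover have "symmetric (with_proj K)" using K(4) by (auto simp: symmetric_def intro: symI)
    moreover have "fst e \<in> pverts K" "snd e \<in> pverts K" "fst e \<noteq> snd e" if "e \<in> parcs K" for e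
      using K(1-3)[of "fst e" "snd e"] that by simp_all
    ultimately show ?thesis using finK by unfold_locales blast+
  qed
  from assms(2) show ?thesis
  proof cases
    case (del_edge u v)
    show ?thesis unfolding del_edge
    proof (rule I)
      show "finite (pverts (delete_edge G u v))" using fin by (simp add: delete_edge_def)
    qed (simp add: delete_edge_def, use wf sym in blast)
  next
    case (del_vertex v)
    show ?thesis unfolding del_vertex
    proof (rule I)
      show "finite (pverts (delete_vertex G v))" using fin by (simp add: delete_vertex_def)
    qed (simp add: delete_vertex_def, use wf sym in blast)
  next
    case (contract u v)
    then have uv: "u \<in> pverts G" "u \<noteq> v" using wf by auto
    define f where "f = (\<lambda>x. if x = v then u else x)"
    have f: "f x \<in> pverts G - {v}" if "x \<in> pverts G" for x
      using that uv by (auto simp: f_def)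
    have H: "pverts H = pverts G - {v}"
      "parcs H = {(f x, f y) |x y. (x, y) \<in> parcs G \<and> f x \<noteq> f y}"
      by (simp_all add: contract contract_edge_def f_def Let_def)
    show ?thesis
    proof (rule I)
      show "finite (pverts H)" using fin H by simp
    next
      fix a b assume "(a, b) \<in> parcs H"
      then obtain x y where xy: "a = f x" "b = f y" "(x, y) \<in> parcs G" "f x \<noteq> f y"
        using H by blast
      moreover have "a \<in> pverts H" using f[OF wf(1)[OF xy(3)]] xy(1) H(1) by simp
      moreover have "(b, a) \<in> parcs H" unfolding H(2) using xy sym[OF xy(3)] by fastforce
      ultimately show "a \<in> pverts H \<and> a \<noteq> b \<and> (b, a) \<in> parcs H" by simp
    qed
  qed
qed

definition is_minor :: "'b pair_pre_digraph \<Rightarrow> 'a pair_pre_digraph \<Rightarrow> bool" where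
  "is_minor H G \<longleftrightarrow> (\<exists>H'. minor_step\<^sup>*\<^sup>* G H' \<and> digraph_iso (with_proj H') (with_proj H))"

definition minor_free :: "'b pair_pre_digraph \<Rightarrow> 'a pair_pre_digraph \<Rightarrow> bool" where
  "minor_free H G \<longleftrightarrow> \<not> is_minor H G"

definition proper_coloring :: "'a pair_pre_digraph \<Rightarrow> ('a \<Rightarrow> 'c) \<Rightarrow> bool" where
  "proper_coloring G c \<longleftrightarrow> (\<forall>(u, v) \<in> parcs G. c u \<noteq> c v)"

definition colorable :: "nat \<Rightarrow> 'a pair_pre_digraph \<Rightarrow> bool" where
  "colorable k G \<longleftrightarrow> (\<exists>c :: 'a \<Rightarrow> nat. proper_coloring G c \<and> card (c ` pverts G) \<le> k)"

definition odd_coloring :: "'a pair_pre_digraph \<Rightarrow> ('a \<Rightarrow> 'c) \<Rightarrow> bool" where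
  "odd_coloring G c \<longleftrightarrow> proper_coloring G c \<and>
     (\<forall>v \<in> pverts G. neighborhood G v \<noteq> {} \<longrightarrow>
        (\<exists>a. odd (card {u \<in> neighborhood G v. c u = a})))"

definition odd_chromatic_number :: "'a pair_pre_digraph \<Rightarrow> nat" where
  "odd_chromatic_number G =
     (LEAST n. \<exists>c :: 'a \<Rightarrow> nat. odd_coloring G c \<and> card (c ` pverts G) = n)"

text \<open>The minimum is attained, since every coloring with pairwise distinct colors is odd.\<close>

lemma odd_chromatic_number_attained:
  fixes G :: "'a pair_pre_digraph"
  assumes "pair_graph G"
  shows "\<exists>c :: 'a \<Rightarrow> nat. odd_coloring G c \<and> card (c ` pverts G) = odd_chromatic_number G"
proof -
  interpret pair_graph G by fact
  obtain c :: "'a \<Rightarrow> nat" where c: "inj_on c (pverts G)"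
    using finite_imp_inj_to_nat_seg pair_finite_verts by metis
  have "\<exists>a. odd (card {u \<in> neighborhood G v. c u = a})" if ne: "neighborhood G v \<noteq> {}" for v
  proof -
    obtain w where w: "w \<in> neighborhood G v" using ne by blast
    have "{u \<in> neighborhood G v. c u = c w} = {w}"
      using w c by (auto simp: neighborhood_def inj_on_def dest: in_arcsD2)
    then have "odd (card {u \<in> neighborhood G v. c u = c w})" by simp
    then show ?thesis ..
  qed
  moreover have "proper_coloring G c"
    using c by (auto simp: proper_coloring_def inj_on_def dest: in_arcsD1 in_arcsD2 no_loops')
  ultimately have "odd_coloring G c" by (simp add: odd_coloring_def)
  then have "\<exists>n. \<exists>c :: 'a \<Rightarrow> nat. odd_coloring G c \<and> card (c ` pverts G) = n" by blast
  from LeastI_ex[OF this] show ?thesis unfolding odd_chromatic_number_def .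
qed

end

theory Submission
  imports Defs
begin

text \<open>
  It suffices to find a set B of vertices, properly coloured with k - 1 colours, such that every
  vertex outside B sees some colour of B an odd number of times and every nonisolated vertex of B
  has a neighbour outside B: contracting the vertices of B into such neighbours yields a minor on the
  complement, and a k-colouring of it with fresh colours gives every vertex of B a neighbour whose
  colour is unique.

  B is built by induction on k, one colour per step. In a connected graph choose a set I of vertices
  at pairwise distance at least three whose closed neighbourhood D is connected and dominates the
  rest. Every neighbour of I sees I exactly once, so I gets a colour of its own; and contracting D
  shows that the clique minors of the rest have smaller order, so the induction goes on there. It stops
  at forests, where a single colour suffices: a tree has an independent set that every other vertex
  sees an odd number of times.
\<close>

subsection \<open>Connected sets and clique models\<close>

text \<open>Connectedness is phrased by cuts: some edge leaves every nonempty proper subset.\<close>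

definition conn :: "('a \<Rightarrow> 'a \<Rightarrow> bool) \<Rightarrow> 'a set \<Rightarrow> bool" where
  "conn E S \<longleftrightarrow> S \<noteq> {} \<and> (\<forall>T \<subseteq> S. T \<noteq> {} \<longrightarrow> T \<noteq> S \<longrightarrow> (\<exists>x\<in>T. \<exists>y\<in>S - T. E x y))"

text \<open>The sets \<open>f i\<close> are the branch sets of a \<open>K_n\<close> minor. Stated
  for a relation and a vertex set, models pass to subsets and to contracted relations without new
  graphs.\<close>

definition clique_model :: "nat \<Rightarrow> ('a \<Rightarrow> 'a \<Rightarrow> bool) \<Rightarrow> 'a set \<Rightarrow> bool" where
  "clique_model n E V \<longleftrightarrow> (\<exists>f :: nat \<Rightarrow> 'a set. (\<forall>i<n. f i \<subseteq> V \<and> conn E (f i)) \<and>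
     (\<forall>i<n. \<forall>j<n. i \<noteq> j \<longrightarrow> f i \<inter> f j = {} \<and> (\<exists>x\<in>f i. \<exists>y\<in>f j. E x y)))"

lemma conn_nonempty: "conn E S \<Longrightarrow> S \<noteq> {}"
  by (simp add: conn_def)

lemma conn_edge:
  assumes "conn E S" "T \<subseteq> S" "T \<noteq> {}" "T \<noteq> S"
  shows "\<exists>x\<in>T. \<exists>y\<in>S - T. E x y"
  using assms by (simp add: conn_def)

lemma conn_singleton: "conn E {x}"
  by (auto simp: conn_def)

text \<open>A cut of the image pulls back along \<open>q\<close> to a cut of \<open>S\<close>, and
  the edge leaving it is not collapsed by \<open>q\<close>. Hence only edges with distinct images
  have to survive, as in a contraction.\<close>

lemma conn_image:
  assumes "conn E S"
    and "\<And>x y. x \<in> S \<Longrightarrow> y \<in> S \<Longrightarrow> E x y \<Longrightarrow> q x \<noteq> q y \<Longrightarrow> E' (q x) (q y)"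
  shows "conn E' (q ` S)"
  unfolding conn_def
proof (intro conjI allI impI)
  show "q ` S \<noteq> {}" using conn_nonempty[OF assms(1)] by simp
  fix T assume T: "T \<subseteq> q ` S" "T \<noteq> {}" "T \<noteq> q ` S"
  let ?U = "{s \<in> S. q s \<in> T}"
  have "?U \<subseteq> S" "?U \<noteq> {}" "?U \<noteq> S" using T by blast+
  from conn_edge[OF assms(1) this] obtain x y where xy: "x \<in> ?U" "y \<in> S - ?U" "E x y" by blast
  then have "q x \<in> T" "q y \<in> q ` S - T" "q x \<noteq> q y" by auto
  then show "\<exists>x\<in>T. \<exists>y\<in>q ` S - T. E' x y" using assms(2)[of x y] xy by blast
qed

lemma conn_mono:
  assumes "conn E S" "\<And>x y. x \<in> S \<Longrightarrow> y \<in> S \<Longrightarrow> E x y \<Longrightarrow> E' x y"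
  shows "conn E' S"
  using conn_image[OF assms(1), where q = id and E' = E'] assms(2) by simp

text \<open>A cut of the union either splits some class, and an edge inside that class leaves it, or
  consists of whole classes and so induces a cut of \<open>S\<close>.\<close>

lemma conn_UN:
  assumes S: "conn E' S"
    and cls: "\<And>a. a \<in> S \<Longrightarrow> conn E (cls a)"
    and edge: "\<And>a b. a \<in> S \<Longrightarrow> b \<in> S \<Longrightarrow> E' a b \<Longrightarrow> \<exists>x\<in>cls a. \<exists>y\<in>cls b. E x y"
  shows "conn E (\<Union>a\<in>S. cls a)"
  unfolding conn_def
proof (intro conjI allI impI)
  show "(\<Union>a\<in>S. cls a) \<noteq> {}" using conn_nonempty[OF S] conn_nonempty[OF cls] by blast
  fix T assume T: "T \<subseteq> (\<Union>a\<in>S. cls a)" "T \<noteq> {}" "T \<noteq> (\<Union>a\<in>S. cls a)"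
  show "\<exists>x\<in>T. \<exists>y\<in>(\<Union>a\<in>S. cls a) - T. E x y"
  proof (cases "\<exists>a\<in>S. cls a \<inter> T \<noteq> {} \<and> \<not> cls a \<subseteq> T")
    case True
    then obtain a where a: "a \<in> S" "cls a \<inter> T \<noteq> {}" "cls a \<inter> T \<noteq> cls a" by blast
    from conn_edge[OF cls[OF a(1)] _ a(2,3)] obtain x y
      where "x \<in> cls a \<inter> T" "y \<in> cls a - (cls a \<inter> T)" "E x y" by blast
    then show ?thesis using a(1) by blast
  next
    case False
    let ?U = "{a \<in> S. cls a \<subseteq> T}"
    have "?U \<subseteq> S" "?U \<noteq> {}" "?U \<noteq> S" using T False by blast+
    from conn_edge[OF S this] obtain a b where ab: "a \<in> ?U" "b \<in> S - ?U" "E' a b" by blast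
    then obtain x y where "x \<in> cls a" "y \<in> cls b" "E x y" using edge by blast
    then show ?thesis using ab False by blast
  qed
qed

lemma conn_union:
  assumes "symp E" "conn E S" "conn E T" "x \<in> S" "y \<in> T" "E x y"
  shows "conn E (S \<union> T)"
  unfolding conn_def
proof (intro conjI allI impI)
  show "S \<union> T \<noteq> {}" using assms(4) by blast
  fix A assume A: "A \<subseteq> S \<union> T" "A \<noteq> {}" "A \<noteq> S \<union> T"
  show "\<exists>a\<in>A. \<exists>b\<in>S \<union> T - A. E a b"
  proof (cases "A \<inter> S = {} \<or> A \<inter> S = S")
    case False
    then have "\<exists>a\<in>A \<inter> S. \<exists>b\<in>S - A \<inter> S. E a b" by (intro conn_edge[OF assms(2)]) auto
    then show ?thesis by blast
  next
    case S: True
    show ?thesis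
    proof (cases "A \<inter> T = {} \<or> A \<inter> T = T")
      case False
      then have "\<exists>a\<in>A \<inter> T. \<exists>b\<in>T - A \<inter> T. E a b" by (intro conn_edge[OF assms(3)]) auto
      then show ?thesis by blast
    next
      case True
      with S A have "x \<in> A \<and> y \<notin> A \<or> x \<notin> A \<and> y \<in> A" using assms(4,5) by blast
      then show ?thesis using assms(4-6) sympD[OF assms(1)] by blast
    qed
  qed
qed

lemma conn_star:
  assumes "symp E" "\<And>x. x \<in> T \<Longrightarrow> E u x"
  shows "conn E (insert u T)"
  unfolding conn_def
proof (intro conjI allI impI)
  fix A assume A: "A \<subseteq> insert u T" "A \<noteq> {}" "A \<noteq> insert u T"
  show "\<exists>x\<in>A. \<exists>y\<in>insert u T - A. E x y"
  proof (cases "u \<in> A")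
    case True
    then show ?thesis using A assms(2) by blast
  next
    case False
    then obtain x where "x \<in> A" "x \<in> T" using A by blast
    then show ?thesis using False assms(2) sympD[OF assms(1)] by blast
  qed
qed simp

text \<open>\<open>C\<close> is the component of \<open>s\<close> in \<open>V - {r}\<close>, found
  as a connected set of largest size. All edges leaving it end in \<open>r\<close>, so the rest
  stays connected.\<close>

lemma comp_split:
  assumes fin: "finite V" and E: "symp E" and V: "conn E V" and rs: "r \<in> V" "s \<in> V" "s \<noteq> r"
  obtains C where "s \<in> C" "C \<subseteq> V - {r}" "conn E C" "conn E (V - C)"
    "\<And>x y. x \<in> C \<Longrightarrow> y \<in> V - C \<Longrightarrow> E x y \<Longrightarrow> y = r" "\<exists>x\<in>C. E r x"
proof -
  let ?P = "\<lambda>C. s \<in> C \<and> C \<subseteq> V - {r} \<and> conn E C"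
  have "?P {s}" using rs conn_singleton by auto
  moreover have "card C \<le> card V" if "?P C" for C
    using that fin by (meson Diff_subset card_mono subset_trans)
  ultimately obtain C where C: "?P C" and max: "\<And>D. ?P D \<Longrightarrow> card D \<le> card C"
    using ex_has_greatest_nat[of ?P "{s}" card "card V + 1"] by (auto simp: less_Suc_eq_le)
  have finC: "finite C" using C fin by (meson finite_Diff finite_subset)
  have out: "y = r" if "x \<in> C" "y \<in> V - C" "E x y" for x y
  proof (rule ccontr)
    assume "y \<noteq> r"
    moreover have "conn E (C \<union> {y})"
      by (rule conn_union[OF E _ conn_singleton that(1) _ that(3)]) (use C in auto)
    ultimately have "?P (C \<union> {y})" using C that by blast
    from max[OF this] show False using finC that by simp
  qed
  have "conn E (V - C)"
    unfolding conn_def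
  proof (intro conjI allI impI)
    show "V - C \<noteq> {}" using rs C by blast
    fix T assume T: "T \<subseteq> V - C" "T \<noteq> {}" "T \<noteq> V - C"
    \<comment> \<open>The side of the cut that avoids \<open>r\<close> has no edge into
      \<open>C\<close>, so the edge of \<open>V\<close> leaving that side ends on the other side;
      symmetry turns it around if necessary.\<close>
    show "\<exists>x\<in>T. \<exists>y\<in>V - C - T. E x y"
    proof (cases "r \<in> T")
      case False
      then have "T \<subseteq> V" "T \<noteq> V" using T rs by blast+
      from conn_edge[OF V this(1) T(2) this(2)] obtain x y
        where "x \<in> T" "y \<in> V - T" "E x y" by blast
      then show ?thesis using out[of y x] False T sympD[OF E] by blast
    next
      case True
      let ?U = "V - C - T"
      have "?U \<subseteq> V" "?U \<noteq> {}" "?U \<noteq> V" using T True C by blast+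
      from conn_edge[OF V this] obtain x y where "x \<in> ?U" "y \<in> V - ?U" "E x y" by blast
      then show ?thesis using out[of y x] True T sympD[OF E] by blast
    qed
  qed
  moreover have "\<exists>x\<in>C. E r x"
  proof -
    have "C \<subseteq> V" "C \<noteq> {}" "C \<noteq> V" using C rs by blast+
    from conn_edge[OF V this] obtain x y where "x \<in> C" "y \<in> V - C" "E x y" by blast
    then show ?thesis using out sympD[OF E] by blast
  qed
  ultimately show ?thesis using that C out by blast
qed

section \<open>Clique models and their transfer\<close>

lemma clique_modelE:
  assumes "clique_model n E V"
  obtains f where "\<forall>i<n. f i \<subseteq> V" "\<forall>i<n. conn E (f i)"
    "\<forall>i<n. \<forall>j<n. i \<noteq> j \<longrightarrow> f i \<inter> f j = {}"
    "\<forall>i<n. \<forall>j<n. i \<noteq> j \<longrightarrow> (\<exists>x\<in>f i. \<exists>y\<in>f j. E x y)"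
proof -
  obtain f where f: "(\<forall>i<n. f i \<subseteq> V \<and> conn E (f i)) \<and>
     (\<forall>i<n. \<forall>j<n. i \<noteq> j \<longrightarrow> f i \<inter> f j = {} \<and> (\<exists>x\<in>f i. \<exists>y\<in>f j. E x y))"
    using assms unfolding clique_model_def ..
  show ?thesis by (rule that[of f]) (use f in simp_all)
qed

lemma clique_modelI:
  assumes "\<And>i. i < n \<Longrightarrow> f i \<subseteq> V" "\<And>i. i < n \<Longrightarrow> conn E (f i)"
    "\<And>i j. i < n \<Longrightarrow> j < n \<Longrightarrow> i \<noteq> j \<Longrightarrow> f i \<inter> f j = {}"
    "\<And>i j. i < n \<Longrightarrow> j < n \<Longrightarrow> i \<noteq> j \<Longrightarrow> \<exists>x\<in>f i. \<exists>y\<in>f j. E x y"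
  shows "clique_model n E V"
  unfolding clique_model_def using assms by (intro exI[of _ f]) simp

text \<open>The new branch sets are the unions of \<open>cls a\<close> over the old ones. Deletion,
  contraction and renaming are all instances, with \<open>cls a\<close> the set that was shrunk to
  \<open>a\<close>.\<close>

lemma clique_model_lift:
  assumes "clique_model n E' V'"
    and sub: "\<And>a. a \<in> V' \<Longrightarrow> cls a \<subseteq> V" and conn: "\<And>a. a \<in> V' \<Longrightarrow> conn E (cls a)"
    and disj: "\<And>a b. a \<in> V' \<Longrightarrow> b \<in> V' \<Longrightarrow> a \<noteq> b \<Longrightarrow> cls a \<inter> cls b = {}"
    and edge: "\<And>a b. a \<in> V' \<Longrightarrow> b \<in> V' \<Longrightarrow> E' a b \<Longrightarrow> \<exists>x\<in>cls a. \<exists>y\<in>cls b. E x y"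
  shows "clique_model n E V"
proof -
  obtain f where f: "\<forall>i<n. f i \<subseteq> V'" "\<forall>i<n. conn E' (f i)"
    "\<forall>i<n. \<forall>j<n. i \<noteq> j \<longrightarrow> f i \<inter> f j = {}"
    "\<forall>i<n. \<forall>j<n. i \<noteq> j \<longrightarrow> (\<exists>x\<in>f i. \<exists>y\<in>f j. E' x y)"
    by (rule clique_modelE[OF assms(1)])
  note f = f[rule_format]
  show ?thesis
  proof (rule clique_modelI[where f = "\<lambda>i. \<Union>a\<in>f i. cls a"])
    fix i assume i: "i < n"
    show "(\<Union>a\<in>f i. cls a) \<subseteq> V" using f(1)[OF i] sub by blast
    show "conn E (\<Union>a\<in>f i. cls a)"
    proof (rule conn_UN[OF f(2)[OF i]])
      fix a assume "a \<in> f i"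
      then show "conn E (cls a)" using f(1)[OF i] conn by blast
    next
      fix a b assume "a \<in> f i" "b \<in> f i" "E' a b"
      then show "\<exists>x\<in>cls a. \<exists>y\<in>cls b. E x y" using f(1)[OF i] edge by blast
    qed
  next
    fix i j assume ij: "i < n" "j < n" "i \<noteq> j"
    have "cls a \<inter> cls b = {}" if "a \<in> f i" "b \<in> f j" for a b
      using disj[of a b] f(1)[OF ij(1)] f(1)[OF ij(2)] f(3)[OF ij] that by blast
    then show "(\<Union>a\<in>f i. cls a) \<inter> (\<Union>a\<in>f j. cls a) = {}" by blast
    obtain a b where ab: "a \<in> f i" "b \<in> f j" "E' a b" using f(4)[OF ij] by blast
    then have "\<exists>x\<in>cls a. \<exists>y\<in>cls b. E x y"
      using edge[of a b] f(1)[OF ij(1)] f(1)[OF ij(2)] by blast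
    then show "\<exists>x\<in>\<Union>a\<in>f i. cls a. \<exists>y\<in>\<Union>a\<in>f j. cls a. E x y" using ab by blast
  qed
qed

lemma clique_model_mono:
  assumes "clique_model n E V" "V \<subseteq> W"
  shows "clique_model n E W"
  by (rule clique_model_lift[OF assms(1), where cls = "\<lambda>a. {a}"])
    (use assms(2) conn_singleton in auto)

text \<open>\<open>D\<close> itself is the additional branch set: each branch set in
  \<open>W\<close> is nonempty, and any of its vertices has a neighbour in \<open>D\<close>.\<close>

lemma clique_model_Suc:
  assumes E: "symp E" and W: "clique_model n E W" and D: "conn E D" "D \<inter> W = {}" "D \<union> W \<subseteq> V"
    and dom: "\<And>w. w \<in> W \<Longrightarrow> \<exists>d\<in>D. E w d"
  shows "clique_model (Suc n) E V"
proof -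
  obtain f where f: "\<forall>i<n. f i \<subseteq> W" "\<forall>i<n. conn E (f i)"
    "\<forall>i<n. \<forall>j<n. i \<noteq> j \<longrightarrow> f i \<inter> f j = {}"
    "\<forall>i<n. \<forall>j<n. i \<noteq> j \<longrightarrow> (\<exists>x\<in>f i. \<exists>y\<in>f j. E x y)"
    by (rule clique_modelE[OF W])
  note f = f[rule_format]
  have g: "\<exists>x\<in>f i. \<exists>d\<in>D. E x d" if "i < n" for i
    using f(1)[OF that] conn_nonempty[OF f(2)[OF that]] dom by blast
  then have g': "\<exists>d\<in>D. \<exists>x\<in>f i. E d x" if "i < n" for i
    using that sympD[OF E] by metis
  show ?thesis
  proof (rule clique_modelI[where f = "f(n := D)"])
    fix i assume "i < Suc n"
    then show "(f(n := D)) i \<subseteq> V" "conn E ((f(n := D)) i)"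
      using f(1,2)[of i] D by (auto simp: less_Suc_eq)
  next
    fix i j assume ij: "i < Suc n" "j < Suc n" "i \<noteq> j"
    show "(f(n := D)) i \<inter> (f(n := D)) j = {}"
      using f(1)[of i] f(1)[of j] f(3)[of i j] D(2) ij by (auto simp: less_Suc_eq)
    show "\<exists>x\<in>(f(n := D)) i. \<exists>y\<in>(f(n := D)) j. E x y"
      using g[of i] g'[of j] f(4)[of i j] ij by (simp add: less_Suc_eq) (elim disjE; simp)
  qed
qed

subsection \<open>Odd domination in trees\<close>

abbreviation odd_count :: "('a \<Rightarrow> 'a \<Rightarrow> bool) \<Rightarrow> 'a set \<Rightarrow> 'a \<Rightarrow> bool" where
  "odd_count E I v \<equiv> odd (card {u \<in> I. E v u})"

definition independent_in :: "('a \<Rightarrow> 'a \<Rightarrow> bool) \<Rightarrow> 'a set \<Rightarrow> bool" where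
  "independent_in E I \<longleftrightarrow> (\<forall>x\<in>I. \<forall>y\<in>I. \<not> E x y)"

inductive rooted_tree :: "('a \<Rightarrow> 'a \<Rightarrow> bool) \<Rightarrow> 'a set \<Rightarrow> 'a \<Rightarrow> bool" for E where
  root: "rooted_tree E {r} r"
| graft: "rooted_tree E A r \<Longrightarrow> rooted_tree E C s \<Longrightarrow> A \<inter> C = {} \<Longrightarrow> E r s \<Longrightarrow>
    \<forall>x\<in>A. \<forall>y\<in>C. E x y \<longrightarrow> x = r \<and> y = s \<Longrightarrow> rooted_tree E (A \<union> C) r"

lemma rooted_tree_finite: "rooted_tree E V r \<Longrightarrow> finite V \<and> r \<in> V"
  by (induction rule: rooted_tree.induct) auto

text \<open>The parity condition at the root \<^term>\<open>r\<close> is left open, so that trees can be glued at \<^term>\<open>r\<close>.\<close>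

definition odd_dom :: "('a \<Rightarrow> 'a \<Rightarrow> bool) \<Rightarrow> 'a set \<Rightarrow> 'a set \<Rightarrow> 'a \<Rightarrow> bool" where
  "odd_dom E I V r \<longleftrightarrow> I \<subseteq> V \<and> independent_in E I \<and> (\<forall>v\<in>V - I - {r}. odd_count E I v)"

text \<open>Since \<open>r s\<close> is the only edge across, counts change only at
  \<open>r\<close>, by one if \<open>s \<in> J\<close>, and at \<open>s\<close>, by one if
  \<open>r \<in> I\<close>. The assumptions \<open>ok\<close> keep the union independent and make
  the count at \<open>s\<close> odd unless \<open>s\<close> lies in \<open>J\<close>.\<close>

lemma odd_dom_graft:
  assumes E: "symp E" and fin: "finite A" "finite C" and disj: "A \<inter> C = {}" and rs: "E r s"
    and edge: "\<forall>x\<in>A. \<forall>y\<in>C. E x y \<longrightarrow> x = r \<and> y = s" and mem: "r \<in> A" "s \<in> C"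
    and I: "odd_dom E I A r" and J: "odd_dom E J C s"
    and ok: "\<not> (r \<in> I \<and> s \<in> J)" "s \<in> J \<or> odd_count E J s \<noteq> (r \<in> I)"
  shows "odd_dom E (I \<union> J) (A \<union> C) r" "r \<in> I \<union> J \<longleftrightarrow> r \<in> I"
    "odd_count E (I \<union> J) r \<longleftrightarrow> odd_count E I r \<noteq> (s \<in> J)"
proof -
  have IJ: "I \<subseteq> A" "J \<subseteq> C" using I J by (auto simp: odd_dom_def)
  then have finIJ: "finite I" "finite J" using fin finite_subset by blast+
  have sp: "odd_count E (I \<union> J) v \<longleftrightarrow> odd_count E I v \<noteq> odd_count E J v" for v
  proof -
    have "{u \<in> I \<union> J. E v u} = {u \<in> I. E v u} \<union> {u \<in> J. E v u}" by auto
    moreover have "{u \<in> I. E v u} \<inter> {u \<in> J. E v u} = {}" using IJ disj by auto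
    ultimately have "card {u \<in> I \<union> J. E v u} = card {u \<in> I. E v u} + card {u \<in> J. E v u}"
      using finIJ by (simp only: card_Un_disjoint finite_Int finite_Collect_conjI Collect_mem_eq simp_thms)
    then show ?thesis by presburger
  qed
  have J0: "{u \<in> J. E v u} = (if v = r \<and> s \<in> J then {s} else {})" if "v \<in> A" for v
    using edge that IJ(2) rs by auto
  have I0: "{u \<in> I. E v u} = (if v = s \<and> r \<in> I then {r} else {})" if "v \<in> C" for v
  proof -
    have "u = r \<and> v = s" if u: "u \<in> I" "E v u" for u
      using edge \<open>v \<in> C\<close> sympD[OF E u(2)] u(1) IJ(1) by blast
    moreover have "E s r" by (rule sympD[OF E rs])
    ultimately show ?thesis by auto
  qed
  show root: "r \<in> I \<union> J \<longleftrightarrow> r \<in> I" using IJ mem disj by auto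
  show "odd_count E (I \<union> J) r \<longleftrightarrow> odd_count E I r \<noteq> (s \<in> J)"
    unfolding sp J0[OF mem(1)] by simp
  have "independent_in E (I \<union> J)"
    unfolding independent_in_def
  proof (intro ballI notI)
    fix x y assume xy: "x \<in> I \<union> J" "y \<in> I \<union> J" "E x y"
    have no: False if "a \<in> I" "b \<in> J" "E a b" for a b
      using edge that IJ ok(1) by blast
    show False using xy no[of x y] no[of y x] sympD[OF E] I J
      unfolding odd_dom_def independent_in_def by blast
  qed
  moreover have "odd_count E (I \<union> J) v" if "v \<in> A \<union> C - (I \<union> J) - {r}" for v
  proof (cases "v \<in> A")
    case True
    then show ?thesis unfolding sp J0[OF True] using that I by (simp add: odd_dom_def)
  next
    case False
    then have v: "v \<in> C" using that by blast
    show ?thesis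
    proof (cases "v = s")
      case True
      then show ?thesis unfolding sp I0[OF v] using that ok(2) by auto
    next
      case False
      then show ?thesis unfolding sp I0[OF v] using that v J by (simp add: odd_dom_def)
    qed
  qed
  ultimately show "odd_dom E (I \<union> J) (A \<union> C) r" using IJ unfolding odd_dom_def by blast
qed

text \<open>
  The root has three possible states: in the set, out with odd count, out with even count. A tree
  may miss one of them, but that at least two are available is inherited by grafting.
\<close>

lemma rooted_tree_two_of_three:
  assumes "rooted_tree E V r" "symp E" "irreflp E"
  defines "inn \<equiv> \<exists>I. odd_dom E I V r \<and> r \<in> I"
    and "out \<equiv> \<lambda>p. \<exists>I. odd_dom E I V r \<and> r \<notin> I \<and> (odd_count E I r \<longleftrightarrow> p)"
  shows "inn \<and> (out True \<or> out False) \<or> out True \<and> out False"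
  using assms(1) unfolding inn_def out_def
proof (induction rule: rooted_tree.induct)
  case (root r)
  have "odd_dom E {r} {r} r" "odd_dom E {} {r} r"
    using assms(3) by (auto simp: odd_dom_def independent_in_def irreflp_def)
  then show ?case by force
next
  case (graft A r C s)
  have fin: "finite A" "finite C" "r \<in> A" "s \<in> C"
    using rooted_tree_finite[OF graft.hyps(1)] rooted_tree_finite[OF graft.hyps(2)] by simp_all
  define iA where "iA \<longleftrightarrow> (\<exists>I. odd_dom E I A r \<and> r \<in> I)"
  define oA where "oA = (\<lambda>p. \<exists>I. odd_dom E I A r \<and> r \<notin> I \<and> (odd_count E I r \<longleftrightarrow> p))"
  define iC where "iC \<longleftrightarrow> (\<exists>I. odd_dom E I C s \<and> s \<in> I)"
  define oC where "oC = (\<lambda>p. \<exists>I. odd_dom E I C s \<and> s \<notin> I \<and> (odd_count E I s \<longleftrightarrow> p))"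
  define iU where "iU \<longleftrightarrow> (\<exists>I. odd_dom E I (A \<union> C) r \<and> r \<in> I)"
  define oU where "oU = (\<lambda>p. \<exists>I. odd_dom E I (A \<union> C) r \<and> r \<notin> I \<and> (odd_count E I r \<longleftrightarrow> p))"
  note join = odd_dom_graft[OF assms(2) fin(1,2) graft.hyps(3,4,5) fin(3,4)]
  \<comment> \<open>Transitions of the root state: if \<open>s\<close> is out and even, a root in
    the set supplies its missing neighbour; if \<open>s\<close> is out and odd, a root that is out
    keeps its parity; if \<open>s\<close> is in, a root that is out changes its parity.\<close>
  have 1: "iU" if prem: "iA" "oC False"
  proof -
    obtain I J where IJ: "odd_dom E I A r" "r \<in> I" "odd_dom E J C s" "s \<notin> J" "\<not> odd_count E J s"
      using prem unfolding iA_def oC_def by blast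
    then show ?thesis using join[OF IJ(1,3)] unfolding iU_def by blast
  qed
  have 2: "oU p" if prem: "oA p" "oC True" for p
  proof -
    obtain I J where IJ: "odd_dom E I A r" "r \<notin> I" "odd_count E I r \<longleftrightarrow> p"
      "odd_dom E J C s" "s \<notin> J" "odd_count E J s"
      using prem unfolding oA_def oC_def by blast
    then show ?thesis using join[OF IJ(1,4)] unfolding oU_def by blast
  qed
  have 3: "oU (\<not> p)" if prem: "oA p" "iC" for p
  proof -
    obtain I J where IJ: "odd_dom E I A r" "r \<notin> I" "odd_count E I r \<longleftrightarrow> p"
      "odd_dom E J C s" "s \<in> J"
      using prem unfolding oA_def iC_def by blast
    then show ?thesis using join[OF IJ(1,4)] unfolding oU_def by blast
  qed
  have "iA \<and> (oA True \<or> oA False) \<or> oA True \<and> oA False"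
    using graft.IH(1) unfolding iA_def oA_def .
  moreover have "iC \<and> (oC True \<or> oC False) \<or> oC True \<and> oC False"
    using graft.IH(2) unfolding iC_def oC_def .
  \<comment> \<open>With \<open>iC\<close> and \<open>oC True\<close>, any out state of
    \<open>A\<close> yields both out states of the union. Otherwise \<open>oC False\<close> holds:
    \<open>iA\<close> yields \<open>iU\<close>, and distinct out states of \<open>A\<close> yield
    distinct ones.\<close>
  ultimately have "iU \<and> (oU True \<or> oU False) \<or> oU True \<and> oU False"
    using 1 2 3[of True] 3[of False] by auto
  then show ?case unfolding iU_def oU_def .
qed

section \<open>Connected graphs without a \<open>K_3\<close> model are trees\<close>

lemma clique_model_triple:
  assumes "symp E" "conn E A" "conn E B" "conn E C" "A \<union> B \<union> C \<subseteq> V"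
    and disj: "A \<inter> B = {}" "A \<inter> C = {}" "B \<inter> C = {}"
    and edge: "\<exists>x\<in>A. \<exists>y\<in>B. E x y" "\<exists>x\<in>A. \<exists>y\<in>C. E x y" "\<exists>x\<in>B. \<exists>y\<in>C. E x y"
  shows "clique_model 3 E V"
proof -
  have edge': "\<exists>x\<in>B. \<exists>y\<in>A. E x y" "\<exists>x\<in>C. \<exists>y\<in>A. E x y" "\<exists>x\<in>C. \<exists>y\<in>B. E x y"
    using edge sympD[OF assms(1)] by blast+
  have lt: "i = 0 \<or> i = 1 \<or> i = 2" if "i < 3" for i :: nat using that by auto
  show ?thesis
  proof (rule clique_modelI[where f = "\<lambda>i. if i = 0 then A else if i = 1 then B else C"])
    fix i :: nat assume "i < 3"
    from lt[OF this] show "(if i = 0 then A else if i = 1 then B else C) \<subseteq> V"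
      "conn E (if i = 0 then A else if i = 1 then B else C)"
      using assms(2-5) by (elim disjE; simp)+
  next
    fix i j :: nat assume ij: "i < 3" "j < 3" "i \<noteq> j"
    show "(if i = 0 then A else if i = 1 then B else C) \<inter> (if j = 0 then A else if j = 1 then B else C) = {}"
      using lt[OF ij(1)] lt[OF ij(2)] ij(3) disj by (elim disjE; simp add: Int_commute)
    show "\<exists>x\<in>if i = 0 then A else if i = 1 then B else C.
      \<exists>y\<in>if j = 0 then A else if j = 1 then B else C. E x y"
      using lt[OF ij(1)] lt[OF ij(2)] ij(3) edge edge' by (elim disjE; simp)
  qed
qed

text \<open>A component \<open>C\<close> of \<open>V - {r}\<close> contains exactly one neighbour
  \<open>s\<close> of \<open>r\<close>, so \<open>V\<close> arises by grafting the tree on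
  \<open>C\<close> with root \<open>s\<close> onto the tree on \<open>V - C\<close> with root
  \<open>r\<close>.\<close>

lemma rooted_tree_of_conn:
  assumes "finite V" "symp E" "conn E V" "r \<in> V" "\<not> clique_model 3 E V"
  shows "rooted_tree E V r"
  using assms
proof (induction "card V" arbitrary: V r rule: less_induct)
  case less
  note E = less.prems(2)
  show ?case
  proof (cases "V = {r}")
    case True
    then show ?thesis by (simp add: rooted_tree.root)
  next
    case False
    then obtain s0 where s0: "s0 \<in> V" "s0 \<noteq> r" using less.prems(4) by blast
    obtain C where C: "s0 \<in> C" "C \<subseteq> V - {r}" "conn E C" "conn E (V - C)"
      "\<And>x y. x \<in> C \<Longrightarrow> y \<in> V - C \<Longrightarrow> E x y \<Longrightarrow> y = r" "\<exists>x\<in>C. E r x"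
      using comp_split[OF less.prems(1-4) s0] by blast
    then obtain s where s: "s \<in> C" "E r s" by blast
    have finC: "finite C" using C(2) less.prems(1) by (meson finite_Diff finite_subset)
    have uniq: "t = s" if t: "t \<in> C" "E r t" for t
    proof (rule ccontr)
      assume "t \<noteq> s"
      \<comment> \<open>Splitting \<open>C\<close> at a second neighbour \<open>t\<close> of
        \<open>r\<close> into the component \<open>K\<close> of \<open>s\<close> and the rest gives
        the \<open>K_3\<close> model \<open>{r}\<close>, \<open>K\<close>,
        \<open>C - K\<close>.\<close>
      then obtain K where K: "s \<in> K" "K \<subseteq> C - {t}" "conn E K" "conn E (C - K)" "\<exists>x\<in>K. E t x"
        using comp_split[OF finC E C(3) t(1) s(1)] by metis
      have "\<exists>x\<in>K. E r x" "\<exists>x\<in>C - K. E r x" using K(1,2) s t by blast+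
      moreover have "\<exists>x\<in>K. \<exists>y\<in>C - K. E x y" using K(2,5) t(1) sympD[OF E] by blast
      ultimately have "clique_model 3 E V"
        by (intro clique_model_triple[OF E conn_singleton K(3,4)])
          (use K(2) C(2) less.prems(4) in auto)
      then show False using less.prems(5) by simp
    qed
    have cards: "card C < card V" "card (V - C) < card V"
      using C(1,2) less.prems(1,4) by (auto intro!: psubset_card_mono)
    have "rooted_tree E C s"
      by (rule less.hyps[OF cards(1) finC E C(3) s(1)])
        (use less.prems(5) clique_model_mono C(2) in blast)
    moreover have "rooted_tree E (V - C) r"
      by (rule less.hyps[OF cards(2) _ E C(4)])
        (use less.prems clique_model_mono[of 3 E "V - C" V] C(2) in auto)
    moreover have "x = r \<and> y = s" if "x \<in> V - C" "y \<in> C" "E x y" for x y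
      using C(5)[of y x] uniq[of y] that sympD[OF E] by blast
    ultimately have "rooted_tree E ((V - C) \<union> C) r"
      using s(2) by (intro rooted_tree.graft[where s = s]) blast+
    moreover have "(V - C) \<union> C = V" using C(2) by blast
    ultimately show ?thesis by simp
  qed
qed

subsection \<open>Splitting off the vertices coloured with the small palette\<close>

text \<open>
  \<^term>\<open>B\<close> is the set coloured with the small palette. Isolated vertices necessarily lie in
  \<^term>\<open>B\<close>, because every vertex outside needs an odd colour count.
\<close>

definition odd_split :: "nat \<Rightarrow> ('a \<Rightarrow> 'a \<Rightarrow> bool) \<Rightarrow> 'a set \<Rightarrow> 'a set \<Rightarrow> ('a \<Rightarrow> nat) \<Rightarrow> bool" where
  "odd_split m E V B c \<longleftrightarrow> B \<subseteq> V \<and> c ` B \<subseteq> {..<m} \<and>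
     (\<forall>x\<in>B. \<forall>y\<in>B. E x y \<longrightarrow> c x \<noteq> c y) \<and>
     (\<forall>a\<in>V - B. \<exists>t. odd (card {u \<in> B. E a u \<and> c u = t})) \<and>
     (\<forall>b\<in>B. (\<exists>u\<in>V. E b u) \<longrightarrow> (\<exists>a\<in>V - B. E b a))"

lemma odd_split_union:
  assumes E: "symp E" and S: "odd_split m E S B c" and T: "odd_split m E T D d"
    and disj: "S \<inter> T = {}" and no: "\<And>x y. x \<in> S \<Longrightarrow> y \<in> T \<Longrightarrow> \<not> E x y"
  shows "odd_split m E (S \<union> T) (B \<union> D) (\<lambda>x. if x \<in> S then c x else d x)"
proof -
  let ?c = "\<lambda>x. if x \<in> S then c x else d x"
  have sub: "B \<subseteq> S" "D \<subseteq> T" using S T by (auto simp: odd_split_def)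
  have no': "\<not> E y x" if "x \<in> S" "y \<in> T" for x y using no[OF that] sympD[OF E] by blast
  have cS: "{u \<in> B \<union> D. E a u \<and> ?c u = t} = {u \<in> B. E a u \<and> c u = t}" if "a \<in> S" for a t
    using that sub no by auto
  have cT: "{u \<in> B \<union> D. E a u \<and> ?c u = t} = {u \<in> D. E a u \<and> d u = t}" if "a \<in> T" for a t
    using that sub no' disj by auto
  have "\<exists>t. odd (card {u \<in> B \<union> D. E a u \<and> ?c u = t})" if a: "a \<in> (S \<union> T) - (B \<union> D)" for a
  proof (cases "a \<in> S")
    case True
    then show ?thesis unfolding cS[OF True] using a S by (simp add: odd_split_def)
  next
    case False
    then have "a \<in> T" using a by blast
    then show ?thesis unfolding cT[OF \<open>a \<in> T\<close>] using a T by (simp add: odd_split_def)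
  qed
  moreover have "\<forall>b\<in>B \<union> D. (\<exists>u\<in>S \<union> T. E b u) \<longrightarrow> (\<exists>a\<in>(S \<union> T) - (B \<union> D). E b a)"
  proof (intro ballI impI)
    fix b assume b: "b \<in> B \<union> D" "\<exists>u\<in>S \<union> T. E b u"
    then consider "b \<in> B" "\<exists>u\<in>S. E b u" | "b \<in> D" "\<exists>u\<in>T. E b u" using sub no no' by blast
    then show "\<exists>a\<in>(S \<union> T) - (B \<union> D). E b a"
    proof cases
      case 1
      then obtain a where "a \<in> S - B" "E b a" using S unfolding odd_split_def by blast
      then show ?thesis using sub disj by blast
    next
      case 2
      then obtain a where "a \<in> T - D" "E b a" using T unfolding odd_split_def by blast
      then show ?thesis using sub disj by blast
    qed
  qed
  moreover have "?c x \<noteq> ?c y" if xy: "x \<in> B \<union> D" "y \<in> B \<union> D" "E x y" for x y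
  proof -
    consider "x \<in> B" "y \<in> B" | "x \<in> D" "y \<in> D" using xy sub no no' by blast
    then show ?thesis
    proof cases
      case 1
      then show ?thesis using xy(3) S sub unfolding odd_split_def by auto
    next
      case 2
      then have "x \<notin> S" "y \<notin> S" using sub disj by auto
      then show ?thesis using 2 xy(3) T unfolding odd_split_def by auto
    qed
  qed
  moreover have "?c ` (B \<union> D) \<subseteq> {..<m}"
    using S T sub disj unfolding odd_split_def by auto
  ultimately show ?thesis using sub unfolding odd_split_def by blast
qed

text \<open>A nonempty set that is not connected has a cut without edges, and splits of its two
  sides combine; the recursion ends in connected subsets or the empty set.\<close>

lemma odd_split_if_conn:
  assumes "finite V" "symp E"
    and conn: "\<And>S. S \<subseteq> V \<Longrightarrow> conn E S \<Longrightarrow> \<exists>B c. odd_split m E S B c"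
  shows "\<exists>B c. odd_split m E V B c"
proof -
  have "\<exists>B c. odd_split m E S B c" if "S \<subseteq> V" for S
    using that
  proof (induction "card S" arbitrary: S rule: less_induct)
    case less
    have finS: "finite S" using less.prems assms(1) finite_subset by blast
    show ?case
    proof (cases "conn E S \<or> S = {}")
      case True
      moreover have "odd_split m E {} {} (\<lambda>_. 0)" by (simp add: odd_split_def)
      ultimately show ?thesis using conn[OF less.prems] by blast
    next
      case False
      then obtain T where T: "T \<subseteq> S" "T \<noteq> {}" "T \<noteq> S" "\<And>x y. x \<in> T \<Longrightarrow> y \<in> S - T \<Longrightarrow> \<not> E x y"
        unfolding conn_def by blast
      have "card T < card S" "card (S - T) < card S"
        using T(1-3) finS by (auto intro!: psubset_card_mono)
      moreover have "T \<subseteq> V" "S - T \<subseteq> V" using T(1) less.prems by blast+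
      ultimately obtain B c D d where "odd_split m E T B c" "odd_split m E (S - T) D d"
        using less.hyps by meson
      from odd_split_union[OF assms(2) this _ T(4)]
      have "\<exists>B c. odd_split m E (T \<union> (S - T)) B c" by blast
      moreover have "T \<union> (S - T) = S" using T(1) by blast
      ultimately show ?thesis by simp
    qed
  qed
  then show ?thesis by blast
qed

lemma odd_split_forest:
  assumes "finite V" "symp E" "irreflp E" "\<not> clique_model 3 E V"
  shows "\<exists>B c. odd_split 1 E V B c"
proof (rule odd_split_if_conn[OF assms(1,2)])
  fix S assume S: "S \<subseteq> V" "conn E S"
  then obtain r where r: "r \<in> S" using conn_nonempty by blast
  have "rooted_tree E S r"
    using rooted_tree_of_conn[OF _ assms(2) S(2) r] S(1) assms(1,4) clique_model_mono finite_subset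
    by blast
  \<comment> \<open>Of any two root states, one is not "out with even count"; either remaining state
    settles the parity condition left open at \<open>r\<close>.\<close>
  from rooted_tree_two_of_three[OF this assms(2,3)]
  obtain I where I: "odd_dom E I S r" "r \<in> I \<or> odd_count E I r" by blast
  have "odd_count E I a" if "a \<in> S - I" for a using I that unfolding odd_dom_def by blast
  then have "\<exists>t. odd (card {u \<in> I. E a u \<and> (0 :: nat) = t})" if "a \<in> S - I" for a
    using that by (intro exI[of _ "0 :: nat"]) simp
  \<comment> \<open>Independence of \<open>I\<close> makes the single colour proper and puts all
    neighbours in \<open>S\<close> of a vertex of \<open>I\<close> outside \<open>I\<close>.\<close>
  then have "odd_split 1 E S I (\<lambda>_. 0)"
    using I(1) unfolding odd_split_def odd_dom_def independent_in_def by auto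
  then show "\<exists>B c. odd_split 1 E S B c" by blast
qed

section \<open>The induction step through a dominating packing\<close>

text \<open>
  Take \<^term>\<open>I\<close> largest with \<^term>\<open>D\<close> connected. If some vertex had no neighbour in \<^term>\<open>D\<close>, one
  such vertex would be at distance two from \<^term>\<open>D\<close>, and adding it to \<^term>\<open>I\<close> would keep both the
  packing condition and connectedness.
\<close>

lemma dominating_packing:
  assumes fin: "finite V" and E: "symp E" "irreflp E" and V: "conn E V"
  obtains I D where "I \<subseteq> V" "D = {v \<in> V. v \<in> I \<or> (\<exists>i\<in>I. E i v)}" "conn E D"
    "\<And>x y. x \<in> I \<Longrightarrow> y \<in> I \<Longrightarrow> x \<noteq> y \<Longrightarrow> \<not> E x y \<and> \<not> (\<exists>z\<in>V. E x z \<and> E y z)"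
    "\<And>v. v \<in> V - D \<Longrightarrow> \<exists>d\<in>D. E v d"
proof -
  define N where "N I = {v \<in> V. v \<in> I \<or> (\<exists>i\<in>I. E i v)}" for I
  define P where "P I \<longleftrightarrow> I \<subseteq> V \<and> conn E (N I) \<and>
    (\<forall>x\<in>I. \<forall>y\<in>I. x \<noteq> y \<longrightarrow> \<not> E x y \<and> \<not> (\<exists>z\<in>V. E x z \<and> E y z))" for I
  have star: "conn E (N {x})" if "x \<in> V" for x
  proof -
    have "N {x} = insert x {v \<in> V. E x v}" using that by (auto simp: N_def)
    moreover have "conn E (insert x {v \<in> V. E x v})" by (rule conn_star[OF E(1)]) simp
    ultimately show ?thesis by simp
  qed
  obtain v where v: "v \<in> V" using conn_nonempty[OF V] by blast
  then have "P {v}" using star by (auto simp: P_def)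
  moreover have "\<forall>I. P I \<longrightarrow> card I < card V + 1"
    using fin by (auto simp: P_def less_Suc_eq_le intro: card_mono)
  ultimately obtain I where I: "P I" and max: "\<And>J. P J \<Longrightarrow> card J \<le> card I"
    using ex_has_greatest_nat[of P "{v}" card "card V + 1"] by auto
  have IV: "I \<subseteq> V" "I \<subseteq> N I" using I by (auto simp: P_def N_def)
  have finI: "finite I" using IV fin finite_subset by blast
  define U where "U = {v \<in> V - N I. \<forall>d\<in>N I. \<not> E v d}"
  have "U = {}"
  proof (rule ccontr)
    assume "U \<noteq> {}"
    have "N I \<noteq> {}" using I conn_nonempty by (auto simp: P_def)
    then have "U \<subseteq> V" "U \<noteq> V" by (auto simp: U_def N_def)
    from conn_edge[OF V this(1) \<open>U \<noteq> {}\<close> this(2)]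
    obtain x y where xy: "x \<in> U" "y \<in> V - U" "E x y" by blast
    then have x: "x \<in> V" "x \<notin> N I" "\<And>d. d \<in> N I \<Longrightarrow> \<not> E x d" by (auto simp: U_def)
    \<comment> \<open>Being adjacent to \<open>x \<in> U\<close>, \<open>y\<close> lies outside
      \<open>N I\<close>; being outside \<open>U\<close> too, it has a neighbour \<open>d\<close> in
      \<open>N I\<close>. The edge \<open>d y\<close> links \<open>N I\<close> to the star
      \<open>N {x}\<close>.\<close>
    obtain d where d: "d \<in> N I" "E y d" using xy x(3) by (auto simp: U_def)
    have sym: "E b a" if "E a b" for a b using that sympD[OF E(1)] by blast
    have NI: "z \<in> N I" if "z \<in> V" "i \<in> I" "E i z" for i z using that by (auto simp: N_def)
    have "N (insert x I) = N I \<union> N {x}" by (auto simp: N_def)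
    moreover have "conn E (N I \<union> N {x})"
    proof (rule conn_union[OF E(1) _ star[OF x(1)] d(1)])
      show "conn E (N I)" using I by (simp add: P_def)
      show "y \<in> N {x}" using xy by (auto simp: N_def)
      show "E d y" using sym d(2) by blast
    qed
    \<comment> \<open>A common neighbour of \<open>x\<close> and \<open>i\<close> would lie in
      \<open>N I\<close>, where \<open>x\<close> has no neighbour.\<close>
    moreover have "\<not> E x i \<and> \<not> E i x \<and> \<not> (\<exists>z\<in>V. E x z \<and> E i z)" if "i \<in> I" for i
      using that x(3) NI IV(2) sym by blast
    ultimately have "P (insert x I)" using I x(1) unfolding P_def by auto
    moreover have "x \<notin> I" using x(2) IV(2) by blast
    ultimately show False using max[of "insert x I"] finI by simp
  qed
  then have dom: "\<exists>d\<in>N I. E v d" if "v \<in> V - N I" for v using that by (auto simp: U_def)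
  show ?thesis
    by (rule that[OF IV(1), of "N I"]) (use I dom in \<open>auto simp: P_def N_def\<close>)
qed

text \<open>\<open>I\<close> gets the new colour \<open>m\<close>, and \<open>IH\<close> splits
  \<open>W = V - D\<close>. The layer \<open>D - I\<close> stays outside the small palette and
  separates \<open>I\<close> from \<open>W\<close>, so the two parts do not disturb each
  other.\<close>

lemma odd_split_extend:
  assumes fin: "finite V" and E: "symp E" "irreflp E" and V: "conn E V"
    and no_model: "\<not> clique_model (Suc n) E V"
    and IH: "\<And>W. W \<subseteq> V \<Longrightarrow> \<not> clique_model n E W \<Longrightarrow> \<exists>B c. odd_split m E W B c"
  shows "\<exists>B c. odd_split (Suc m) E V B c"
proof -
  obtain I D where I: "I \<subseteq> V" and D: "D = {v \<in> V. v \<in> I \<or> (\<exists>i\<in>I. E i v)}" "conn E D"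
    and pack: "\<And>x y. x \<in> I \<Longrightarrow> y \<in> I \<Longrightarrow> x \<noteq> y \<Longrightarrow> \<not> E x y \<and> \<not> (\<exists>z\<in>V. E x z \<and> E y z)"
    and dom: "\<And>v. v \<in> V - D \<Longrightarrow> \<exists>d\<in>D. E v d"
    using dominating_packing[OF fin E V] by blast
  have sym: "E y x" if "E x y" for x y using that sympD[OF E(1)] by blast
  define W where "W = V - D"
  have "\<not> clique_model n E W"
    using clique_model_Suc[OF E(1) _ D(2), of n W V] no_model dom D(1) unfolding W_def by blast
  then obtain B c where Bc: "odd_split m E W B c" using IH[of W] unfolding W_def by blast
  then have B: "B \<subseteq> W" "c ` B \<subseteq> {..<m}" by (auto simp: odd_split_def)
  have disj: "D \<inter> W = {}" "I \<subseteq> D" using I D(1) by (auto simp: W_def)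
  have IW: "\<not> E i w" "\<not> E w i" if "i \<in> I" "w \<in> W" for i w
    using that D(1) sym unfolding W_def by blast+
  have II: "\<not> E i j" if "i \<in> I" "j \<in> I" for i j
    using that pack E(2) by (metis irreflpD)
  let ?c = "\<lambda>x. if x \<in> I then m else c x"
  have cB: "?c x = c x" "c x < m" if "x \<in> B" for x using that B disj by auto
  have "\<exists>t. odd (card {u \<in> I \<union> B. E a u \<and> ?c u = t})" if a: "a \<in> V - (I \<union> B)" for a
  proof (cases "a \<in> D")
    case True
    then obtain i where i: "i \<in> I" "E i a" using a D(1) by blast
    \<comment> \<open>The packing condition leaves \<open>i\<close> as the only neighbour of
      \<open>a\<close> in \<open>I\<close>, and colour \<open>m\<close> does not occur on
      \<open>B\<close>.\<close>
    have "{u \<in> I \<union> B. E a u \<and> ?c u = m} = {i}"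
      using i a pack[OF i(1)] sym cB by (auto, blast+)
    then have "odd (card {u \<in> I \<union> B. E a u \<and> ?c u = m})" by simp
    then show ?thesis ..
  next
    case False
    then have aW: "a \<in> W - B" using a by (simp add: W_def)
    then obtain t where "odd (card {u \<in> B. E a u \<and> c u = t})"
      using Bc unfolding odd_split_def by blast
    moreover have "{u \<in> I \<union> B. E a u \<and> ?c u = t} = {u \<in> B. E a u \<and> c u = t}"
      using aW IW cB(1) by auto
    ultimately have "odd (card {u \<in> I \<union> B. E a u \<and> ?c u = t})" by (simp only: not_False_eq_True)
    then show ?thesis ..
  qed
  moreover have "?c x \<noteq> ?c y" if "x \<in> I \<union> B" "y \<in> I \<union> B" "E x y" for x y
  proof -
    have "x \<in> B" "y \<in> B" using that II IW B(1) by blast+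
    then show ?thesis using Bc that(3) cB by (auto simp: odd_split_def)
  qed
  \<comment> \<open>The witness lies in \<open>D - I\<close> in both cases: neighbours of
    \<open>I\<close> lie in \<open>D\<close> but not in \<open>I\<close>, and a vertex of
    \<open>B\<close> is dominated by \<open>D\<close> without having a neighbour in
    \<open>I\<close>.\<close>
  moreover have "\<exists>a\<in>V - (I \<union> B). E b a" if b: "b \<in> I \<union> B" "\<exists>u\<in>V. E b u" for b
  proof (cases "b \<in> I")
    case True
    then obtain u where u: "u \<in> V" "E b u" using b by blast
    then have "u \<in> D" "u \<notin> I" using True D(1) II by blast+
    then show ?thesis using u B(1) disj by blast
  next
    case False
    then have bW: "b \<in> W" using b B by blast
    then obtain d where d: "d \<in> D" "E b d" using dom by (auto simp: W_def)
    then have "d \<notin> I" using IW bW by blast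
    then show ?thesis using d D(1) B(1) disj by blast
  qed
  moreover have "?c ` (I \<union> B) \<subseteq> {..<Suc m}" using B(2) by (auto simp: less_Suc_eq)
  moreover have "I \<union> B \<subseteq> V" using I B(1) by (auto simp: W_def)
  ultimately have "odd_split (Suc m) E V (I \<union> B) ?c" unfolding odd_split_def by blast
  then show ?thesis by blast
qed

text \<open>For \<open>k = m + 2\<close> this excludes \<open>K_{k+1}\<close> and uses
  \<open>k - 1\<close> colours. Each round spends one colour and lowers the forbidden order by one,
  down to forests. Every round first passes to connected sets, since the rest left by the previous
  one may fall apart.\<close>

lemma odd_split_exists:
  assumes "finite V" "symp E" "irreflp E" "\<not> clique_model (m + 3) E V"
  shows "\<exists>B c. odd_split (Suc m) E V B c"
  using assms(1,4)
proof (induction m arbitrary: V)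
  case 0
  then show ?case using odd_split_forest[OF _ assms(2,3)] by simp
next
  case (Suc m)
  show ?case
  proof (rule odd_split_if_conn[OF Suc.prems(1) assms(2)])
    fix S assume S: "S \<subseteq> V" "conn E S"
    show "\<exists>B c. odd_split (Suc (Suc m)) E S B c"
    proof (rule odd_split_extend[OF _ assms(2,3) S(2)])
      show "finite S" using S(1) Suc.prems(1) finite_subset by blast
      then show "\<exists>B c. odd_split (Suc m) E W B c" if "W \<subseteq> S" "\<not> clique_model (m + 3) E W" for W
        using Suc.IH that finite_subset by blast
      show "\<not> clique_model (Suc (m + 3)) E S"
        using Suc.prems(2) clique_model_mono[OF _ S(1)] by auto
    qed
  qed
qed

text \<open>
  Contracting each \<^term>\<open>b \<in> B\<close> into a neighbour \<^term>\<open>a\<close> outside \<^term>\<open>B\<close> makes \<^term>\<open>a\<close> adjacent to all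
  other neighbours of \<^term>\<open>b\<close> outside \<^term>\<open>B\<close>; hence the colour of \<^term>\<open>a\<close> occurs exactly once around
  \<^term>\<open>b\<close>.
\<close>

lemma odd_coloring_of_odd_split:
  assumes fin: "finite V" and E: "symp E" "irreflp E" and split: "odd_split m E V B c"
    and no_model: "\<not> clique_model n E V"
    and col: "\<And>A Q. finite A \<Longrightarrow> symp Q \<Longrightarrow> irreflp Q \<Longrightarrow> \<not> clique_model n Q A \<Longrightarrow>
      \<exists>d :: 'a \<Rightarrow> nat. d ` A \<subseteq> {..<k} \<and> (\<forall>x\<in>A. \<forall>y\<in>A. Q x y \<longrightarrow> d x \<noteq> d y)"
  shows "\<exists>d :: 'a \<Rightarrow> nat. d ` V \<subseteq> {..<k + m} \<and> (\<forall>x\<in>V. \<forall>y\<in>V. E x y \<longrightarrow> d x \<noteq> d y) \<and>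
    (\<forall>v\<in>V. (\<exists>u\<in>V. E v u) \<longrightarrow> (\<exists>t. odd (card {u \<in> V. E v u \<and> d u = t})))"
proof -
  have sym: "E y x" if "E x y" for x y using that sympD[OF E(1)] by blast
  have irr: "\<not> E x x" for x using E(2) by (simp add: irreflp_def)
  have B: "B \<subseteq> V" "c ` B \<subseteq> {..<m}" using split by (auto simp: odd_split_def)
  define A where "A = V - B"
  \<comment> \<open>Isolated vertices of \<open>B\<close> have no neighbour to be contracted into
    and impose no parity condition; they are set aside.\<close>
  define good where "good b \<longleftrightarrow> b \<in> B \<and> (\<exists>u\<in>V. E b u)" for b
  have "\<forall>b\<in>B. (\<exists>u\<in>V. E b u) \<longrightarrow> (\<exists>a\<in>V - B. E b a)"
    using split by (simp add: odd_split_def)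
  then have "\<forall>b\<in>Collect good. \<exists>a. a \<in> A \<and> E b a" by (auto simp: good_def A_def)
  then obtain g where "\<forall>b\<in>Collect good. g b \<in> A \<and> E b (g b)" by (rule bchoice[THEN exE])
  then have g: "g b \<in> A \<and> E b (g b)" if "good b" for b using that by simp
  \<comment> \<open>\<open>cls a\<close> is the star contracted to \<open>a\<close>, and
    \<open>Q\<close> is adjacency in the resulting minor on \<open>A\<close>; it contains all edges
    of \<open>E\<close> inside \<open>A\<close>.\<close>
  define cls where "cls a = insert a {b. good b \<and> g b = a}" for a
  define Q where "Q a b \<longleftrightarrow> a \<noteq> b \<and> (\<exists>x\<in>cls a. \<exists>y\<in>cls b. E x y)" for a b
  have Q_free: "\<not> clique_model n Q A"
  proof
    assume "clique_model n Q A"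
    then have "clique_model n E V"
    proof (rule clique_model_lift[where cls = cls])
      fix a assume a: "a \<in> A"
      have "conn E (cls a)" unfolding cls_def
        by (rule conn_star[OF E(1)]) (use g sym in blast)
      then show "conn E (cls a)" .
      show "cls a \<subseteq> V" using a B by (auto simp: cls_def A_def good_def)
    next
      fix a b assume "a \<in> A" "b \<in> A" "a \<noteq> b"
      then show "cls a \<inter> cls b = {}" by (auto simp: cls_def A_def good_def)
    qed (simp add: Q_def)
    then show False using no_model by simp
  qed
  have Q: "finite A" "symp Q" "irreflp Q"
    using fin sym unfolding A_def Q_def symp_def irreflp_def by blast+
  obtain d :: "'a \<Rightarrow> nat"
    where d: "d ` A \<subseteq> {..<k}" "\<forall>x\<in>A. \<forall>y\<in>A. Q x y \<longrightarrow> d x \<noteq> d y"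
    using col[OF Q Q_free] by (elim exE conjE)
  note d = d(1) d(2)[rule_format]
  have dk: "d x < k" if "x \<in> A" for x using d(1) that by blast
  \<comment> \<open>The shift by \<open>k\<close> keeps the palettes disjoint: a colour
    \<open>k + t\<close> is counted on \<open>B\<close> alone, a colour below \<open>k\<close> on
    \<open>A\<close> alone.\<close>
  define e where "e x = (if x \<in> B then k + c x else d x)" for x
  have eB: "e x = k + c x" if "x \<in> B" for x using that by (simp add: e_def)
  have eA: "e x = d x" "x \<notin> B" if "x \<in> A" for x using that by (auto simp: e_def A_def)
  have VAB: "V = A \<union> B" using B by (auto simp: A_def)
  have "e ` V \<subseteq> {..<k + m}" unfolding VAB using B(2) d(1) eA eB by fastforce
  moreover have "e x \<noteq> e y" if xy: "x \<in> V" "y \<in> V" "E x y" for x y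
  proof -
    consider "x \<in> A" "y \<in> A" | "x \<in> A" "y \<in> B" | "x \<in> B" "y \<in> A" | "x \<in> B" "y \<in> B"
      using xy VAB by blast
    then show ?thesis
    proof cases
      case 1
      then have "Q x y" using xy(3) irr by (auto simp: Q_def cls_def)
      then show ?thesis using 1 d(2) eA by auto
    next
      case 2
      then show ?thesis using eA eB dk[of x] by simp
    next
      case 3
      then show ?thesis using eA eB dk[of y] by simp
    next
      case 4
      then show ?thesis using split xy(3) eB by (simp add: odd_split_def)
    qed
  qed
  moreover have "\<exists>t. odd (card {u \<in> V. E v u \<and> e u = t})" if v: "v \<in> V" "\<exists>u\<in>V. E v u" for v
  proof (cases "v \<in> B")
    case False
    then obtain t where "odd (card {u \<in> B. E v u \<and> c u = t})"
      using split v unfolding odd_split_def by blast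
    moreover have "{u \<in> V. E v u \<and> e u = k + t} = {u \<in> B. E v u \<and> c u = t}"
      unfolding VAB using eA(1) eB dk by fastforce
    ultimately have "odd (card {u \<in> V. E v u \<and> e u = k + t})" by (simp only: not_False_eq_True)
    then show ?thesis ..
  next
    case True
    then have gv: "good v" using v by (simp add: good_def)
    have "{u \<in> V. E v u \<and> e u = d (g v)} = {g v}"
    proof (intro equalityI subsetI)
      fix u assume u: "u \<in> {u \<in> V. E v u \<and> e u = d (g v)}"
      then have uA: "u \<in> A" using eB dk g[OF gv] VAB by force
      show "u \<in> {g v}"
      proof (rule ccontr)
        assume "u \<notin> {g v}"
        then have "Q (g v) u" using u gv by (auto simp: Q_def cls_def)
        then show False using d(2)[of "g v" u] g[OF gv] u uA eA by auto
      qed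
    next
      fix u assume "u \<in> {g v}"
      then show "u \<in> {u \<in> V. E v u \<and> e u = d (g v)}" using g[OF gv] VAB eA by auto
    qed
    then have "odd (card {u \<in> V. E v u \<and> e u = d (g v)})" by simp
    then show ?thesis ..
  qed
  ultimately show ?thesis by blast
qed

subsection \<open>Minors of graphs as clique models\<close>

abbreviation adj :: "'a pair_pre_digraph \<Rightarrow> 'a \<Rightarrow> 'a \<Rightarrow> bool" where
  "adj G x y \<equiv> (x, y) \<in> parcs G"

lemma pair_graph_iff:
  "pair_graph G \<longleftrightarrow> finite (pverts G) \<and>
    (\<forall>x y. adj G x y \<longrightarrow> x \<in> pverts G \<and> y \<in> pverts G \<and> x \<noteq> y \<and> adj G y x)"
proof
  assume "pair_graph G"
  then interpret pair_graph G .
  show "finite (pverts G) \<and>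
    (\<forall>x y. adj G x y \<longrightarrow> x \<in> pverts G \<and> y \<in> pverts G \<and> x \<noteq> y \<and> adj G y x)"
    using pair_finite_verts in_arcsD1 in_arcsD2 no_loops' sym_arcs
    by (auto simp: symmetric_def elim: symE)
next
  assume G: "finite (pverts G) \<and>
    (\<forall>x y. adj G x y \<longrightarrow> x \<in> pverts G \<and> y \<in> pverts G \<and> x \<noteq> y \<and> adj G y x)"
  then have "parcs G \<subseteq> pverts G \<times> pverts G" by auto
  then have "finite (parcs G)" using G by (meson finite_SigmaI finite_subset)
  moreover have "symmetric (with_proj G)" using G by (auto simp: symmetric_def intro: symI)
  moreover have "fst e \<in> pverts G" "snd e \<in> pverts G" "fst e \<noteq> snd e" if "e \<in> parcs G" for e
    using that G by (metis prod.collapse)+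
  ultimately show "pair_graph G" using G by unfold_locales blast+
qed

text \<open>Branch sets are pulled back vertex by vertex: after a contraction \<open>u\<close>
  stands for \<open>{u, v}\<close>, and every other vertex stands for itself.\<close>

lemma clique_model_minor_step:
  assumes G: "pair_graph G" and step: "minor_step G H" and H: "clique_model n (adj H) (pverts H)"
  shows "clique_model n (adj G) (pverts G)"
  using step
proof cases
  case (del_edge u v)
  show ?thesis
    by (rule clique_model_lift[OF H, where cls = "\<lambda>a. {a}"])
      (auto simp: del_edge delete_edge_def conn_singleton)
next
  case (del_vertex v)
  show ?thesis
    by (rule clique_model_lift[OF H, where cls = "\<lambda>a. {a}"])
      (auto simp: del_vertex delete_vertex_def conn_singleton)
next
  case (contract u v)
  have sym: "symp (adj G)" using G by (auto simp: pair_graph_iff symp_def)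
  have uv: "u \<in> pverts G" "v \<in> pverts G" using contract G by (auto simp: pair_graph_iff)
  have "conn (adj G) {u, v}" using conn_star[OF sym, of "{v}" u] contract(2) by simp
  then show ?thesis
    using uv
    by (intro clique_model_lift[OF H, where cls = "\<lambda>a. if a = u then {u, v} else {a}"])
      (auto simp: contract contract_edge_def Let_def conn_singleton split: if_splits)
qed

text \<open>The last graph of the minor sequence is a copy of \<open>K_n\<close>, whose single
  vertices form a model; it is pulled back through the steps.\<close>

lemma clique_model_of_minor:
  assumes "pair_graph G" "is_minor (complete_graph n) G"
  shows "clique_model n (adj G) (pverts G)"
proof -
  obtain H where H: "minor_step\<^sup>*\<^sup>* G H" "digraph_iso (with_proj H) (with_proj (complete_graph n))"
    using assms(2) by (auto simp: is_minor_def)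
  have "pair_graph H" using H(1) assms(1)
    by (induction rule: rtranclp_induct) (auto intro: pair_graph_minor_step)
  obtain h where h: "pre_digraph.digraph_isomorphism (with_proj H) h"
    "with_proj (complete_graph n) = app_iso h (with_proj H)"
    using H(2) by (auto simp: digraph_iso_def)
  have "clique_model n (adj H) (pverts H)"
  proof -
    have inj: "inj_on (iso_verts h) (pverts H)"
      using h(1) by (simp add: pre_digraph.digraph_isomorphism_def)
    have verts: "iso_verts h ` pverts H = {..<n}"
      using arg_cong[OF h(2), of verts] by (simp add: complete_graph_def)
    have arcs: "iso_arcs h ` parcs H = parcs (complete_graph n)"
      and ends: "iso_tail h = fst" "iso_head h = snd"
      using arg_cong[OF h(2), of arcs] arg_cong[OF h(2), of tail] arg_cong[OF h(2), of head]
      by simp_all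
    define p where "p = the_inv_into (pverts H) (iso_verts h)"
    have p: "p i \<in> pverts H" "iso_verts h (p i) = i" if "i < n" for i
      using that verts the_inv_into_into[OF inj, of i "pverts H"] f_the_inv_into_f[OF inj, of i]
      by (auto simp: p_def)
    have "adj H (p i) (p j)" if ij: "i < n" "j < n" "i \<noteq> j" for i j
    proof -
      have "(i, j) \<in> iso_arcs h ` parcs H" using ij by (simp add: arcs complete_graph_def)
      then obtain a where a: "a \<in> parcs H" "iso_arcs h a = (i, j)" by auto
      then have "iso_verts h (fst a) = i" "iso_verts h (snd a) = j"
        using h(1) ends by (auto simp: pre_digraph.digraph_isomorphism_def)
      moreover have "fst a \<in> pverts H" "snd a \<in> pverts H"
        using a(1) \<open>pair_graph H\<close> unfolding pair_graph_iff by (metis prod.collapse)+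
      ultimately have "fst a = p i" "snd a = p j" using inj p ij by (metis inj_onD)+
      then show ?thesis using a(1) by (metis prod.collapse)
    qed
    moreover have "p i \<noteq> p j" if "i < n" "j < n" "i \<noteq> j" for i j using that p by metis
    ultimately show ?thesis unfolding clique_model_def
      using p(1) conn_singleton by (intro exI[of _ "\<lambda>i. {p i}"]) auto
  qed
  with H(1) assms(1) show ?thesis
    by (induction rule: converse_rtranclp_induct)
      (auto intro: clique_model_minor_step pair_graph_minor_step)
qed

lemma is_minor_step: "minor_step G H \<Longrightarrow> is_minor K H \<Longrightarrow> is_minor K G"
  unfolding is_minor_def by (meson converse_rtranclp_into_rtranclp)

text \<open>Delete a vertex outside all branch sets or contract an edge inside one: the model
  survives and the vertex count drops. When neither is possible, the branch sets are singletons
  covering \<open>G\<close>, so \<open>G\<close> itself is complete.\<close>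

lemma is_minor_of_clique_model:
  assumes "pair_graph G" "clique_model n (adj G) (pverts G)"
  shows "is_minor (complete_graph n) G"
  using assms
proof (induction "card (pverts G)" arbitrary: G rule: less_induct)
  case less
  note G = less.prems(1)[unfolded pair_graph_iff]
  obtain f where f: "\<forall>i<n. f i \<subseteq> pverts G" "\<forall>i<n. conn (adj G) (f i)"
    "\<forall>i<n. \<forall>j<n. i \<noteq> j \<longrightarrow> f i \<inter> f j = {}"
    "\<forall>i<n. \<forall>j<n. i \<noteq> j \<longrightarrow> (\<exists>x\<in>f i. \<exists>y\<in>f j. adj G x y)"
    by (rule clique_modelE[OF less.prems(2)])
  note f = f[rule_format]
  have step: ?case
    if H: "minor_step G H" "pverts H = pverts G - {v}" "v \<in> pverts G"
      "clique_model n (adj H) (pverts H)" for H v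
  proof (rule is_minor_step[OF H(1)], rule less.hyps)
    show "card (pverts H) < card (pverts G)"
      unfolding H(2) using G H(3) by (intro card_Diff1_less) simp_all
    show "pair_graph H" by (rule pair_graph_minor_step[OF less.prems(1) H(1)])
  qed (rule H(4))
  let ?P = "\<exists>v\<in>pverts G. \<forall>i<n. v \<notin> f i"
  let ?Q = "\<exists>i<n. \<exists>x\<in>f i. \<exists>y\<in>f i. adj G x y"
  consider ?P | ?Q | "\<not> ?P" "\<not> ?Q" by argo
  then show ?case
  proof cases
    case 1
    then obtain v where 1: "v \<in> pverts G" "\<forall>i<n. v \<notin> f i" by blast
    let ?H = "delete_vertex G v"
    have H: "adj ?H a b" if "adj G a b" "a \<noteq> v" "b \<noteq> v" for a b
      using that by (simp add: delete_vertex_def)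
    have verts: "pverts ?H = pverts G - {v}" by (simp add: delete_vertex_def)
    show ?thesis
    proof (rule step[OF del_vertex[OF 1(1)] verts 1(1)], rule clique_modelI[where f = f])
      fix i assume i: "i < n"
      show "f i \<subseteq> pverts ?H" using f(1)[OF i] 1(2) i verts by blast
      show "conn (adj ?H) (f i)"
        by (rule conn_mono[OF f(2)[OF i]], rule H) (use i 1(2) in auto)
    next
      fix i j assume ij: "i < n" "j < n" "i \<noteq> j"
      show "f i \<inter> f j = {}" by (rule f(3)[OF ij])
      obtain a b where "a \<in> f i" "b \<in> f j" "adj G a b" using f(4)[OF ij] by blast
      moreover from this have "a \<noteq> v" "b \<noteq> v" using 1(2) ij by auto
      ultimately show "\<exists>a\<in>f i. \<exists>b\<in>f j. adj ?H a b" using H by blast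
    qed
  next
    case 2
    then obtain i x y where 2: "i < n" "x \<in> f i" "y \<in> f i" "adj G x y" by blast
    define q where "q = (\<lambda>z. if z = y then x else z)"
    let ?H = "contract_edge G x y"
    have verts: "pverts ?H = pverts G - {y}" by (simp add: contract_edge_def Let_def)
    have H: "adj ?H (q a) (q b)" if "adj G a b" "q a \<noteq> q b" for a b
    proof -
      have "parcs ?H = {(q c, q d) |c d. adj G c d \<and> q c \<noteq> q d}"
        by (simp add: contract_edge_def q_def Let_def)
      then show ?thesis using that by blast
    qed
    have xy: "x \<noteq> y" "y \<in> pverts G" using 2(4) G by auto
    have notin: "x \<notin> f j" "y \<notin> f j" if "j < n" "j \<noteq> i" for j
      using f(3)[OF that(1) 2(1) that(2)] 2(2,3) by blast+
    \<comment> \<open>Both ends of the contracted edge lie in \<open>f i\<close>, so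
      \<open>f i\<close> merely loses \<open>y\<close> and the other branch sets are fixed.\<close>
    have img: "q ` f j = (if j = i then f i - {y} else f j)" if "j < n" for j
    proof (cases "j = i")
      case True
      then show ?thesis using 2(2) xy by (auto simp: q_def)
    next
      case False
      then have "q z = z" if "z \<in> f j" for z
        using that notin[OF \<open>j < n\<close> False] by (auto simp: q_def)
      then show ?thesis using False by simp
    qed
    show ?thesis
    proof (rule step[OF contract[OF 2(4)] verts xy(2)], rule clique_modelI[where f = "\<lambda>j. q ` f j"])
      fix j assume j: "j < n"
      show "q ` f j \<subseteq> pverts ?H"
        using img[OF j] f(1)[OF j] notin[OF j] verts by (auto split: if_splits)
      show "conn (adj ?H) (q ` f j)"
        by (rule conn_image[OF f(2)[OF j]], rule H)
    next
      fix j l assume jl: "j < n" "l < n" "j \<noteq> l"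
      show disj: "q ` f j \<inter> q ` f l = {}"
        using img[OF jl(1)] img[OF jl(2)] f(3)[OF jl] jl(3) by (auto split: if_splits)
      obtain a b where "a \<in> f j" "b \<in> f l" "adj G a b" using f(4)[OF jl] by blast
      then show "\<exists>a\<in>q ` f j. \<exists>b\<in>q ` f l. adj ?H a b" using H[of a b] disj by blast
    qed
  next
    case 3
    then have 3: "\<forall>v\<in>pverts G. \<exists>i<n. v \<in> f i" "\<forall>i<n. \<forall>x\<in>f i. \<forall>y\<in>f i. \<not> adj G x y"
      by simp_all
    have "\<exists>x. f i = {x}" if i: "i < n" for i
    proof -
      obtain x where x: "x \<in> f i" using conn_nonempty[OF f(2)[OF i]] by blast
      have "f i = {x}"
      proof (rule ccontr)
        assume "f i \<noteq> {x}"
        then have "\<exists>a\<in>{x}. \<exists>b\<in>f i - {x}. adj G a b"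
          using x by (intro conn_edge[OF f(2)[OF i]]) auto
        then show False using 3(2) i x by blast
      qed
      then show ?thesis ..
    qed
    then have "\<forall>i\<in>{..<n}. \<exists>x. f i = {x}" by simp
    then obtain p where "\<forall>i\<in>{..<n}. f i = {p i}" by (rule bchoice[THEN exE])
    then have p: "f i = {p i}" if "i < n" for i using that by simp
    have verts: "pverts G = p ` {..<n}"
    proof (intro equalityI subsetI)
      fix v assume "v \<in> pverts G"
      then obtain i where "i < n" "v \<in> f i" using 3(1) by blast
      then show "v \<in> p ` {..<n}" using p by auto
    next
      fix v assume "v \<in> p ` {..<n}"
      then obtain i where "i < n" "v = p i" by blast
      then show "v \<in> pverts G" using f(1)[of i] p by auto
    qed
    have inj: "inj_on p {..<n}"
    proof (rule inj_onI)
      fix i j assume "i \<in> {..<n}" "j \<in> {..<n}" "p i = p j"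
      then show "i = j" using f(3)[of i j] p[of i] p[of j] by auto
    qed
    have arcs: "adj G (p i) (p j) \<longleftrightarrow> i \<noteq> j" if "i < n" "j < n" for i j
      using f(4)[OF that] p[OF that(1)] p[OF that(2)] G by auto
    define r where "r = the_inv_into {..<n} p"
    have r: "r (p i) = i" if "i < n" for i
      unfolding r_def using that inj by (simp add: the_inv_into_f_f)
    let ?h = "\<lparr>iso_verts = r, iso_arcs = map_prod r r, iso_head = snd, iso_tail = fst\<rparr>"
    have injr: "inj_on r (pverts G)" using verts r by (auto simp: inj_on_def)
    have sub: "parcs G \<subseteq> pverts G \<times> pverts G" using G by auto
    have "inj_on (map_prod r r) (parcs G)"
      using map_prod_inj_on[OF injr injr] sub inj_on_subset by blast
    moreover have "wf_digraph (with_proj G)"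
      using G by (auto simp: wf_digraph_wp_iff pair_wf_digraph_def)
    ultimately have "pre_digraph.digraph_isomorphism (with_proj G) ?h"
      using injr by (simp add: pre_digraph.digraph_isomorphism_def)
    moreover have "map_prod r r ` parcs G = parcs (complete_graph n)"
    proof (intro equalityI subsetI)
      fix e assume "e \<in> map_prod r r ` parcs G"
      then obtain a b where ab: "adj G a b" "e = (r a, r b)" by auto
      then obtain i j where "i < n" "j < n" "a = p i" "b = p j" using sub verts by auto
      then show "e \<in> parcs (complete_graph n)"
        using ab r arcs by (simp add: complete_graph_def)
    next
      fix e assume "e \<in> parcs (complete_graph n)"
      then obtain i j where ij: "e = (i, j)" "i < n" "j < n" "i \<noteq> j"
        by (auto simp: complete_graph_def)
      then have "adj G (p i) (p j)" "e = map_prod r r (p i, p j)" using arcs r by simp_all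
      then show "e \<in> map_prod r r ` parcs G" by blast
    qed
    moreover have "r ` pverts G = pverts (complete_graph n)"
      using r by (force simp: verts complete_graph_def)
    ultimately have "digraph_iso (with_proj G) (with_proj (complete_graph n))"
      unfolding digraph_iso_def by (intro exI[of _ ?h]) (simp add: app_iso_def with_proj_def)
    then show ?thesis unfolding is_minor_def by blast
  qed
qed

section \<open>From minors to models, and the final bound\<close>

lemma minor_free_complete_iff:
  assumes "pair_graph G"
  shows "minor_free (complete_graph n) G \<longleftrightarrow> \<not> clique_model n (adj G) (pverts G)"
  using assms clique_model_of_minor is_minor_of_clique_model unfolding minor_free_def by blast

text \<open>The colouring hypothesis speaks of graphs on \<open>nat\<close>; since \<open>A\<close>
  is finite, an injection \<open>h\<close> copies \<open>Q\<close> there, and a model in the copy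
  would lift back to \<open>A\<close>.\<close>

lemma coloring_if_no_clique_model:
  fixes A :: "'a set"
  assumes col: "\<And>H :: nat pair_pre_digraph.
      pair_graph H \<Longrightarrow> minor_free (complete_graph n) H \<Longrightarrow> colorable k H"
    and A: "finite A" "symp Q" "irreflp Q" "\<not> clique_model n Q A"
  shows "\<exists>d :: 'a \<Rightarrow> nat. d ` A \<subseteq> {..<k} \<and> (\<forall>x\<in>A. \<forall>y\<in>A. Q x y \<longrightarrow> d x \<noteq> d y)"
proof -
  obtain h :: "'a \<Rightarrow> nat" where h: "inj_on h A"
    using finite_imp_inj_to_nat_seg[OF A(1)] by metis
  let ?H = "\<lparr>pverts = h ` A, parcs = {(h x, h y) |x y. x \<in> A \<and> y \<in> A \<and> Q x y}\<rparr>"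
  have inv: "the_inv_into A h (h x) = x" if "x \<in> A" for x
    using that h by (simp add: the_inv_into_f_f)
  have H: "pair_graph ?H"
    unfolding pair_graph_iff using A h by (auto simp: irreflp_def symp_def inj_on_def)
  moreover have "minor_free (complete_graph n) ?H"
    unfolding minor_free_complete_iff[OF H]
  proof
    assume "clique_model n (adj ?H) (pverts ?H)"
    then have "clique_model n Q A"
      by (rule clique_model_lift[where cls = "\<lambda>a. {the_inv_into A h a}"])
        (auto simp: inv conn_singleton)
    then show False using A(4) by simp
  qed
  ultimately obtain c :: "nat \<Rightarrow> nat"
    where c: "proper_coloring ?H c" "card (c ` h ` A) \<le> k"
    using col unfolding colorable_def by fastforce
  \<comment> \<open>\<open>c\<close> uses at most \<open>k\<close> colours, but of arbitrary values;
    \<open>e\<close> renumbers them below \<open>k\<close>.\<close>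
  obtain e where e: "bij_betw e (c ` h ` A) {0..<card (c ` h ` A)}"
    using ex_bij_betw_finite_nat[of "c ` h ` A"] A(1) by auto
  have "e (c (h x)) < k" if "x \<in> A" for x
    using bij_betw_apply[OF e, of "c (h x)"] that c(2) by simp
  moreover have "e (c (h x)) \<noteq> e (c (h y))" if "x \<in> A" "y \<in> A" "Q x y" for x y
  proof -
    have "c (h x) \<noteq> c (h y)" using c(1) that by (auto simp: proper_coloring_def)
    then show ?thesis using bij_betw_imp_inj_on[OF e] that by (auto simp: inj_on_def)
  qed
  ultimately show ?thesis by (intro exI[of _ "e \<circ> c \<circ> h"]) auto
qed

theorem lemma3p6:
  fixes k :: nat and G :: "'a pair_pre_digraph"
  assumes "k \<ge> 1"
    and "\<And>H :: nat pair_pre_digraph.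
           pair_graph H \<Longrightarrow> minor_free (complete_graph (k + 1)) H \<Longrightarrow> colorable k H"
    and "pair_graph G"
    and "minor_free (complete_graph (k + 1)) G"
  shows "odd_chromatic_number G \<le> 2 * k - 1"
proof -
  let ?V = "pverts G"
  note G = assms(3)[unfolded pair_graph_iff]
  have E: "finite ?V" "symp (adj G)" "irreflp (adj G)"
    using G by (auto simp: symp_def irreflp_def)
  have no: "\<not> clique_model (k + 1) (adj G) ?V"
    using assms(4) minor_free_complete_iff[OF assms(3)] by blast
  have col: "\<exists>d :: 'a \<Rightarrow> nat. d ` A \<subseteq> {..<k} \<and> (\<forall>x\<in>A. \<forall>y\<in>A. Q x y \<longrightarrow> d x \<noteq> d y)"
    if "finite A" "symp Q" "irreflp Q" "\<not> clique_model (k + 1) Q A" for A Q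
    by (rule coloring_if_no_clique_model[OF _ that]) (rule assms(2))
  have "\<exists>d :: 'a \<Rightarrow> nat. d ` ?V \<subseteq> {..<2 * k - 1} \<and>
    (\<forall>x\<in>?V. \<forall>y\<in>?V. adj G x y \<longrightarrow> d x \<noteq> d y) \<and>
    (\<forall>v\<in>?V. (\<exists>u\<in>?V. adj G v u) \<longrightarrow> (\<exists>t. odd (card {u \<in> ?V. adj G v u \<and> d u = t})))"
  \<comment> \<open>For \<open>k = 1\<close> the graph is edgeless and one colour is allowed; the
    odd split starts only at \<open>K_3\<close>, that is, at \<open>k = 2\<close>.\<close>
  proof (cases "k = 1")
    case True
    have "\<not> adj G x y" for x y
    proof
      assume xy: "adj G x y"
      let ?f = "\<lambda>i :: nat. if i = 0 then {x} else {y}"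
      have "i < 2 \<longleftrightarrow> i = 0 \<or> i = 1" for i :: nat by auto
      then have "clique_model 2 (adj G) ?V" unfolding clique_model_def
        using xy G conn_singleton[of "adj G"] by (intro exI[of _ ?f]) auto
      then show False using no True by (simp add: numeral_2_eq_2)
    qed
    then show ?thesis using True by (intro exI[of _ "\<lambda>_. 0"]) auto
  next
    case False
    \<comment> \<open>Chosen so that \<open>m + 3 = k + 1\<close> is the forbidden order; the split
      then uses \<open>Suc m = k - 1\<close> colours on top of the \<open>k\<close> for the
      rest.\<close>
    define m where "m = k - 2"
    have k: "k = m + 2" using False assms(1) by (simp add: m_def)
    have "\<not> clique_model (m + 3) (adj G) ?V" using no k by (simp add: eval_nat_numeral)
    then obtain B c where split: "odd_split (Suc m) (adj G) ?V B c"
      using odd_split_exists[OF E] by blast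
    have "k + Suc m = 2 * k - 1" using k by simp
    then show ?thesis
      using odd_coloring_of_odd_split[where k = k, OF E split no] col by simp
  qed
  then obtain d :: "'a \<Rightarrow> nat" where d: "d ` ?V \<subseteq> {..<2 * k - 1}"
    "\<forall>x\<in>?V. \<forall>y\<in>?V. adj G x y \<longrightarrow> d x \<noteq> d y"
    "\<forall>v\<in>?V. (\<exists>u\<in>?V. adj G v u) \<longrightarrow> (\<exists>t. odd (card {u \<in> ?V. adj G v u \<and> d u = t}))"
    by (elim exE conjE)
  have nbr: "{u \<in> neighborhood G v. d u = t} = {u \<in> ?V. adj G v u \<and> d u = t}" for v t
    using G by (auto simp: neighborhood_def)
  have "\<exists>u\<in>?V. adj G v u" if "neighborhood G v \<noteq> {}" for v
    using that G by (auto simp: neighborhood_def)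
  then have "\<exists>t. odd (card {u \<in> neighborhood G v. d u = t})"
    if "v \<in> ?V" "neighborhood G v \<noteq> {}" for v
    unfolding nbr using d(3) that by blast
  moreover have "proper_coloring G d"
    using d(2) G by (auto simp: proper_coloring_def)
  ultimately have "odd_coloring G d" by (simp add: odd_coloring_def)
  then have "odd_chromatic_number G \<le> card (d ` ?V)"
    unfolding odd_chromatic_number_def by (intro Least_le) blast
  also have "\<dots> \<le> 2 * k - 1" using card_mono[OF _ d(1)] by simp
  finally show ?thesis .
qed

end
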